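(* Let $p>0$, $u$ a weight on $\mathbb R$ and $w$ a weight on $(0,\infty)$. If $H:\Lambda^p_u(w)\to\Lambda^{p,\infty}_u(w)$ is bounded, then $M:\Lambda^p_u(w)\to\Lambda^{p,\infty}_u(w)$ is bounded.
   Context: A weight $u$ on $\mathbb R$ is locally integrable with $u>0$ a.e.; $u(E)=\int_Eu$. A weight $w$ on $(0,\infty)$ is nonnegative locally integrable, $W(t)=\int_0^tw$. $f^*_u(t)=\inf\{y>0:u(\{|f|>y\})\le t\}$; $\|f\|_{\Lambda^p_u(w)}=\left(\int_0^\infty(f^*_u)^pw\right)^{1/p}$, $\|f\|_{\Lambda^{p,\infty}_u(w)}=\sup_{t>0}f^*_u(t)W(t)^{1/p}$. $Hf(x)=\frac1\pi\lim_{\varepsilon\to0^+}\int_{|x-y|>\varepsilon}\frac{f(y)}{x-y}dy$; boundedness of $H$ means $Hf$ defined a.e. for every $f\in\Lambda^p_u(w)$ with $\|Hf\|_{\Lambda^{p,\infty}_u(w)}\le C\|f\|_{\Lambda^p_u(w)}$. $Mf(x)=\sup_{I\ni x}\frac1{|I|}\int_I|f|$ over intervals $I$ containing $x$; boundedness of $M$ means $\|Mf\|_{\Lambda^{p,\infty}_u(w)}\le C\|f\|_{\Lambda^p_u(w)}$. *)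

theory Defs
  imports "HOL-Analysis.Analysis"
begin

definition enn_powr :: "ennreal \<Rightarrow> real \<Rightarrow> ennreal" where
  "enn_powr x a = (if x = \<infinity> then \<infinity> else ennreal (enn2real x powr a))"

definition weight_R :: "(real \<Rightarrow> real) \<Rightarrow> bool" where
  "weight_R u \<longleftrightarrow> (\<forall>a b. set_integrable lebesgue {a..b} u) \<and> (AE x in lebesgue. u x > 0)"

text \<open>Weight on (0,infinity): nonnegative, locally integrable (so that W(t) is finite).\<close>
definition weight_pos :: "(real \<Rightarrow> real) \<Rightarrow> bool" where
  "weight_pos w \<longleftrightarrow> (\<forall>x>0. w x \<ge> 0) \<and> (\<forall>t>0. set_integrable lebesgue {0..t} w)"

definition Wfun :: "(real \<Rightarrow> real) \<Rightarrow> real \<Rightarrow> real" where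
  "Wfun w t = (LINT s:{0..t}|lebesgue. w s)"

definition umeas :: "(real \<Rightarrow> real) \<Rightarrow> real set \<Rightarrow> ennreal" where
  "umeas u E = (\<integral>\<^sup>+ x. ennreal (u x) * indicator E x \<partial>lebesgue)"

text \<open>Decreasing rearrangement with respect to u of a function given by its modulus g = |f|.\<close>
definition dec_rearr :: "(real \<Rightarrow> real) \<Rightarrow> (real \<Rightarrow> ennreal) \<Rightarrow> real \<Rightarrow> ennreal" where
  "dec_rearr u g t =
     Inf (ennreal ` {y::real. y > 0 \<and> umeas u {x. g x > ennreal y} \<le> ennreal t})"

definition lorentz_norm :: "real \<Rightarrow> (real \<Rightarrow> real) \<Rightarrow> (real \<Rightarrow> real) \<Rightarrow> (real \<Rightarrow> ennreal) \<Rightarrow> ennreal" where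
  "lorentz_norm p u w g =
     enn_powr (\<integral>\<^sup>+ t. enn_powr (dec_rearr u g t) p * ennreal (w t) * indicator {0<..} t \<partial>lebesgue) (1 / p)"

definition weak_lorentz_norm :: "real \<Rightarrow> (real \<Rightarrow> real) \<Rightarrow> (real \<Rightarrow> real) \<Rightarrow> (real \<Rightarrow> ennreal) \<Rightarrow> ennreal" where
  "weak_lorentz_norm p u w g =
     (SUP t\<in>{0<..}. dec_rearr u g t * ennreal (Wfun w t powr (1 / p)))"

definition hilbert_trunc :: "(real \<Rightarrow> real) \<Rightarrow> real \<Rightarrow> real \<Rightarrow> real" where
  "hilbert_trunc f x \<epsilon> = (LINT y:{y. \<bar>x - y\<bar> > \<epsilon>}|lebesgue. f y / (x - y))"

definition hilbert_defined :: "(real \<Rightarrow> real) \<Rightarrow> real \<Rightarrow> bool" where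
  "hilbert_defined f x \<longleftrightarrow>
     (\<forall>\<^sub>F \<epsilon> in at_right 0. set_integrable lebesgue {y. \<bar>x - y\<bar> > \<epsilon>} (\<lambda>y. f y / (x - y))) \<and>
     (\<exists>L. (hilbert_trunc f x \<longlongrightarrow> L) (at_right 0))"

definition hilbert :: "(real \<Rightarrow> real) \<Rightarrow> real \<Rightarrow> real" where
  "hilbert f x = (if hilbert_defined f x then (1 / pi) * Lim (at_right 0) (hilbert_trunc f x) else 0)"

definition maximal :: "(real \<Rightarrow> real) \<Rightarrow> real \<Rightarrow> ennreal" where
  "maximal f x = (SUP I\<in>{(a, b). a \<le> x \<and> x \<le> b \<and> a < b}.
      (\<integral>\<^sup>+ y. ennreal \<bar>f y\<bar> * indicator {fst I..snd I} y \<partial>lebesgue) / ennreal (snd I - fst I))"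

definition in_lorentz :: "real \<Rightarrow> (real \<Rightarrow> real) \<Rightarrow> (real \<Rightarrow> real) \<Rightarrow> (real \<Rightarrow> real) \<Rightarrow> bool" where
  "in_lorentz p u w f \<longleftrightarrow> f \<in> borel_measurable lebesgue \<and> lorentz_norm p u w (\<lambda>x. ennreal \<bar>f x\<bar>) < \<infinity>"

definition hilbert_bounded :: "real \<Rightarrow> (real \<Rightarrow> real) \<Rightarrow> (real \<Rightarrow> real) \<Rightarrow> bool" where
  "hilbert_bounded p u w \<longleftrightarrow> (\<exists>C::real. \<forall>f. in_lorentz p u w f \<longrightarrow>
     (AE x in lebesgue. hilbert_defined f x) \<and>
     weak_lorentz_norm p u w (\<lambda>x. ennreal \<bar>hilbert f x\<bar>) \<le> ennreal C * lorentz_norm p u w (\<lambda>x. ennreal \<bar>f x\<bar>))"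

definition maximal_bounded :: "real \<Rightarrow> (real \<Rightarrow> real) \<Rightarrow> (real \<Rightarrow> real) \<Rightarrow> bool" where
  "maximal_bounded p u w \<longleftrightarrow> (\<exists>C::real. \<forall>f. in_lorentz p u w f \<longrightarrow>
     weak_lorentz_norm p u w (maximal f) \<le> ennreal C * lorentz_norm p u w (\<lambda>x. ennreal \<bar>f x\<bar>))"

end

theory Submission
  imports Defs
begin

text \<open>
  Let \<open>f \<ge> 0\<close> have averages at least \<open>\<lambda>\<close> on finitely many disjoint intervals, and cut each interval
  at its median with respect to \<open>f\<close>. A point of the fivefold dilate of an interval lies on one side
  of that median, so the Hilbert transform of the part of \<open>f\<close> on the other side has modulus at least
  \<open>\<lambda> / (6 \<pi>)\<close> there. Attach random signs to all these parts. Flipping the sign of one part changes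
  the transform of the sum by twice the transform of that part, so at every point of the union of
  the dilates at least half of the sign choices give modulus at least \<open>\<lambda> / (6 \<pi>)\<close>. Averaging yields
  one choice of signs for which this holds on half of the union in \<open>u\<close>-measure, and the weak-type
  bound for \<open>H\<close> applies to the signed sum, whose modulus is at most \<open>f\<close>. By the Vitali covering
  lemma this is the weak-type bound for \<open>M\<close>, up to the factor two in the argument of \<open>W\<close>.

  That factor is removed by a doubling property of \<open>W\<close>: apply the same estimate to the indicator of
  an eighth of an interval \<open>I\<close> carrying at most an eighth of \<open>u(I)\<close>. Intervals of every \<open>u\<close>-measure
  exist because \<open>u\<close> has infinite total mass; otherwise the constant function \<open>1\<close>, whose Hilbert
  transform is nowhere defined, would belong to the Lorentz space.
\<close>

section \<open>Weighted measure, rearrangements and Lorentz norms\<close>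

text \<open>\<open>nn_integral\<close> is monotone on arbitrary functions, so this also compares
  sets not known to be measurable, such as superlevel sets of the maximal function.\<close>

lemma umeas_mono_AE: "AE x in lebesgue. x \<in> A \<longrightarrow> x \<in> B \<Longrightarrow> umeas u A \<le> umeas u B"
  unfolding umeas_def by (intro nn_integral_mono_AE) (auto simp: indicator_def elim!: eventually_mono)

lemma umeas_mono: "A \<subseteq> B \<Longrightarrow> umeas u A \<le> umeas u B"
  by (rule umeas_mono_AE) auto

lemma weight_R_measurable:
  assumes "weight_R u"
  shows "u \<in> borel_measurable lebesgue"
proof (rule borel_measurable_LIMSEQ_real)
  fix n :: nat
  show "(\<lambda>x. indicator {- real n..real n} x * u x) \<in> borel_measurable lebesgue"
    using assms by (auto simp: weight_R_def set_integrable_def dest!: borel_measurable_integrable)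
next
  fix x :: real
  obtain N where "\<bar>x\<bar> \<le> real N" using real_arch_simple by blast
  then have "\<forall>\<^sub>F n in sequentially. u x = indicator {- real n..real n} x * u x"
    by (intro eventually_sequentiallyI[of N]) (auto simp: indicator_def)
  then show "(\<lambda>n. indicator {- real n..real n} x * u x) \<longlonglongrightarrow> u x"
    by (rule Lim_transform_eventually[OF tendsto_const])
qed

lemma umeas_eq_emeasure:
  assumes "weight_R u" "E \<in> sets lebesgue"
  shows "umeas u E = emeasure (density lebesgue (\<lambda>x. ennreal (u x))) E"
  using assms weight_R_measurable[OF assms(1)] by (simp add: umeas_def emeasure_density)

lemma umeas_interval:
  assumes "weight_R u"
  shows "umeas u {a..b} = ennreal (LINT x:{a..b}|lebesgue. u x)"
proof -
  have pos: "AE x in lebesgue. 0 \<le> indicator {a..b} x * u x"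
    using assms by (auto simp: weight_R_def indicator_def elim!: eventually_mono)
  have "umeas u {a..b} = (\<integral>\<^sup>+ x. ennreal (indicator {a..b} x * u x) \<partial>lebesgue)"
    unfolding umeas_def by (intro nn_integral_cong) (auto simp: indicator_def)
  also have "\<dots> = ennreal (LINT x:{a..b}|lebesgue. u x)"
    using assms pos
    by (auto simp: weight_R_def set_integrable_def set_lebesgue_integral_def
        intro!: nn_integral_eq_integral)
  finally show ?thesis .
qed

lemma enn_powr_mono: "0 \<le> p \<Longrightarrow> x \<le> y \<Longrightarrow> enn_powr x p \<le> enn_powr y p"
  by (auto simp: enn_powr_def top_unique less_top intro!: ennreal_leI powr_mono2 enn2real_mono)

lemma dec_rearr_mono:
  assumes "\<And>x. g x \<le> h x"
  shows "dec_rearr u g t \<le> dec_rearr u h t"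
  unfolding dec_rearr_def
proof (intro Inf_superset_mono image_mono Collect_mono impI conjI)
  fix y :: real assume *: "0 < y \<and> umeas u {x. ennreal y < h x} \<le> ennreal t"
  have "umeas u {x. ennreal y < g x} \<le> umeas u {x. ennreal y < h x}"
    using assms by (intro umeas_mono) (auto intro: less_le_trans)
  with * show "umeas u {x. ennreal y < g x} \<le> ennreal t" by auto
qed auto

lemma lorentz_norm_mono:
  assumes "\<And>x. g x \<le> h x" "0 < p"
  shows "lorentz_norm p u w g \<le> lorentz_norm p u w h"
  unfolding lorentz_norm_def using assms
  by (intro enn_powr_mono nn_integral_mono mult_right_mono dec_rearr_mono) auto

lemma in_lorentz_mono:
  assumes "in_lorentz p u w f" "g \<in> borel_measurable lebesgue" "\<And>x. \<bar>g x\<bar> \<le> \<bar>f x\<bar>" "0 < p"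
  shows "in_lorentz p u w g"
  using assms lorentz_norm_mono[of "\<lambda>x. ennreal \<bar>g x\<bar>" "\<lambda>x. ennreal \<bar>f x\<bar>" p u w]
  by (auto simp: in_lorentz_def intro: le_less_trans)

text \<open>For \<open>y < c\<close> the set where \<open>g\<close> exceeds \<open>y\<close>
  contains the set where \<open>g\<close> is at least \<open>c\<close>, whose measure already
  exceeds \<open>t\<close>. Hence no such \<open>y\<close> is admissible in the infimum.\<close>

lemma dec_rearr_ge:
  assumes "ennreal t < umeas u {x. ennreal c \<le> g x}" "0 \<le> c"
  shows "ennreal c \<le> dec_rearr u g t"
  unfolding dec_rearr_def
proof (intro Inf_greatest, safe)
  fix y :: real assume y: "0 < y" "umeas u {x. ennreal y < g x} \<le> ennreal t"
  show "ennreal c \<le> ennreal y"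
  proof (rule ccontr)
    assume "\<not> ennreal c \<le> ennreal y"
    then have "umeas u {x. ennreal c \<le> g x} \<le> umeas u {x. ennreal y < g x}"
      by (intro umeas_mono) auto
    with y assms show False by auto
  qed
qed

text \<open>The rearrangement of an indicator is at most 1 and vanishes from \<open>s\<close> on, so
  only the integral of \<open>w\<close> up to \<open>s\<close> remains.\<close>

lemma lorentz_norm_indicator_le:
  assumes p: "0 < p" and w: "weight_pos w" and J: "umeas u J \<le> ennreal s" and s: "0 < s"
  shows "lorentz_norm p u w (\<lambda>x. ennreal \<bar>indicator J x\<bar>) \<le> ennreal (Wfun w s powr (1 / p))"
proof -
  let ?g = "\<lambda>x. ennreal \<bar>indicator J x :: real\<bar>"
  have le1: "dec_rearr u ?g t \<le> 1" for t
    unfolding dec_rearr_def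
  proof (rule Inf_lower)
    have "{x. ennreal 1 < ?g x} = {}" by (auto simp: indicator_def)
    then have "umeas u {x. ennreal 1 < ?g x} \<le> ennreal t" by (simp add: umeas_def)
    then have "ennreal 1 \<in> ennreal ` {y. 0 < y \<and> umeas u {x. ennreal y < ?g x} \<le> ennreal t}"
      by (intro imageI) auto
    then show "1 \<in> ennreal ` {y. 0 < y \<and> umeas u {x. ennreal y < ?g x} \<le> ennreal t}" by simp
  qed
  have eq0: "dec_rearr u ?g t = 0" if "s \<le> t" for t
  proof -
    \<comment> \<open>The infimum runs over \<open>y > 0\<close> only, so the value zero is
      approached and not attained.\<close>
    have le_e: "dec_rearr u ?g t \<le> 0 + ennreal e" if "0 < e" for e :: real
    proof -
      have "umeas u {x. ennreal e < ?g x} \<le> umeas u J"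
        by (intro umeas_mono) (auto simp: indicator_def split: if_splits)
      also have "\<dots> \<le> ennreal t" using J \<open>s \<le> t\<close> by (meson ennreal_leI order_trans)
      finally show ?thesis unfolding dec_rearr_def
        using that by (intro Inf_lower2[of "ennreal e"]) auto
    qed
    have "dec_rearr u ?g t \<le> 0" by (rule ennreal_le_epsilon) (rule le_e)
    then show ?thesis by simp
  qed
  have int: "set_integrable lebesgue {0..s} w" using w s by (auto simp: weight_pos_def)
  have Wnn: "AE x in lebesgue. 0 \<le> indicator {0..s} x * w x"
  proof -
    \<comment> \<open>\<open>weight_pos\<close> leaves the sign of \<open>w\<close> at 0 open, so
      this null point is discarded.\<close>
    have "AE x in lebesgue. x \<noteq> (0::real)" by (rule AE_completion[OF AE_lborel_singleton])
    then show ?thesis using w by (auto simp: weight_pos_def indicator_def elim!: eventually_mono)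
  qed
  have "(\<integral>\<^sup>+ t. enn_powr (dec_rearr u ?g t) p * ennreal (w t) * indicator {0<..} t \<partial>lebesgue)
      \<le> (\<integral>\<^sup>+ t. ennreal (indicator {0..s} t * w t) \<partial>lebesgue)"
  proof (rule nn_integral_mono)
    fix t :: real
    have "enn_powr (dec_rearr u ?g t) p \<le> enn_powr 1 p"
      using le1 p by (intro enn_powr_mono) auto
    also have "\<dots> = 1" by (simp add: enn_powr_def)
    finally have "enn_powr (dec_rearr u ?g t) p * ennreal (w t) \<le> 1 * ennreal (w t)"
      by (intro mult_right_mono) auto
    moreover have "enn_powr (dec_rearr u ?g t) p = 0" if "s \<le> t"
      using eq0[OF that] by (simp add: enn_powr_def)
    ultimately show "enn_powr (dec_rearr u ?g t) p * ennreal (w t) * indicator {0<..} t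
        \<le> ennreal (indicator {0..s} t * w t)"
      by (cases "s \<le> t") (auto simp: indicator_def)
  qed
  also have "\<dots> = ennreal (Wfun w s)"
    using int Wnn by (auto simp: Wfun_def set_integrable_def set_lebesgue_integral_def
        intro!: nn_integral_eq_integral)
  finally have "lorentz_norm p u w ?g \<le> enn_powr (ennreal (Wfun w s)) (1/p)"
    unfolding lorentz_norm_def using p by (intro enn_powr_mono) auto
  also have "\<dots> = ennreal (Wfun w s powr (1 / p))"
  proof -
    have "0 \<le> Wfun w s" unfolding Wfun_def set_lebesgue_integral_def
      using Wnn by (intro integral_nonneg_AE) auto
    then show ?thesis by (simp add: enn_powr_def)
  qed
  finally show ?thesis .
qed

section \<open>The Hilbert transform: measurability, linearity, lower bounds\<close>

lemma sigma_finite_lebesgue: "sigma_finite_measure (lebesgue :: real measure)"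
proof
  show "\<exists>A. countable A \<and> A \<subseteq> sets (lebesgue :: real measure) \<and> \<Union>A = space lebesgue \<and> (\<forall>a\<in>A. emeasure lebesgue a \<noteq> \<infinity>)"
  proof (intro exI[of _ "range (\<lambda>n::nat. {- real n..real n})"] conjI ballI)
    have "x \<in> (\<Union>n::nat. {- real n..real n})" for x :: real
      using real_arch_simple[of "\<bar>x\<bar>"] by (auto simp: abs_le_iff) (metis minus_le_iff)
    then show "\<Union>(range (\<lambda>n::nat. {- real n..real n})) = space lebesgue"
      by (simp add: set_eq_iff)
    show "emeasure lebesgue a \<noteq> \<infinity>" if "a \<in> range (\<lambda>n::nat. {- real n..real n})" for a
      using that by auto
  qed auto
qed

text \<open>The truncated kernel is jointly measurable on the product of two copies of
  \<open>lebesgue\<close>; sigma-finiteness then makes the integral over one variable measurable in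
  the other.\<close>

lemma hilbert_trunc_measurable:
  assumes f[measurable]: "f \<in> borel_measurable lebesgue"
  shows "(\<lambda>x. hilbert_trunc f x \<epsilon>) \<in> borel_measurable lebesgue"
proof -
  interpret sigma_finite_measure "lebesgue :: real measure" by (rule sigma_finite_lebesgue)
  have [measurable]: "(\<lambda>x::real. x) \<in> borel_measurable lebesgue"
    by (simp add: measurable_completion)
  have [measurable]: "fst \<in> borel_measurable ((lebesgue::real measure) \<Otimes>\<^sub>M (lebesgue::real measure))"
    using measurable_compose[OF measurable_fst, of "\<lambda>x. x" lebesgue borel lebesgue] by simp
  have [measurable]: "snd \<in> borel_measurable ((lebesgue::real measure) \<Otimes>\<^sub>M (lebesgue::real measure))"
    using measurable_compose[OF measurable_snd, of "\<lambda>x. x" lebesgue borel lebesgue] by simp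
  have "(\<lambda>z. indicator {y. \<bar>fst z - y\<bar> > \<epsilon>} (snd z) *\<^sub>R (f (snd z) / (fst z - snd z)))
      = (\<lambda>z. if \<bar>fst z - snd z\<bar> > \<epsilon> then f (snd z) / (fst z - snd z) else 0)"
    by (auto simp: fun_eq_iff)
  moreover have "\<dots> \<in> borel_measurable ((lebesgue::real measure) \<Otimes>\<^sub>M (lebesgue::real measure))"
    by measurable
  ultimately have "(\<lambda>z. indicator {y. \<bar>fst z - y\<bar> > \<epsilon>} (snd z) *\<^sub>R (f (snd z) / (fst z - snd z)))
      \<in> borel_measurable ((lebesgue::real measure) \<Otimes>\<^sub>M (lebesgue::real measure))" by simp
  then show ?thesis
    unfolding hilbert_trunc_def set_lebesgue_integral_def
    by (intro borel_measurable_lebesgue_integral) (simp add: case_prod_beta')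
qed

lemma hilbert_tendsto:
  assumes "hilbert_defined f x"
  shows "((\<lambda>\<epsilon>. 1 / pi * hilbert_trunc f x \<epsilon>) \<longlongrightarrow> hilbert f x) (at_right 0)"
proof -
  obtain L where L: "(hilbert_trunc f x \<longlongrightarrow> L) (at_right 0)"
    using assms by (auto simp: hilbert_defined_def)
  then have "Lim (at_right 0) (hilbert_trunc f x) = L" by (intro tendsto_Lim) auto
  with assms L show ?thesis by (auto simp: hilbert_def intro!: tendsto_intros)
qed

text \<open>Along \<open>\<epsilon> = 1 / (n + 1)\<close> the transform is almost everywhere a limit
  of measurable functions. On the exceptional null set \<open>hilbert\<close> has the default value
  0 and \<open>lim\<close> an arbitrary one; completeness of Lebesgue measure absorbs the
  difference.\<close>

lemma hilbert_measurable:
  assumes f: "f \<in> borel_measurable lebesgue" and d: "AE x in lebesgue. hilbert_defined f x"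
  shows "hilbert f \<in> borel_measurable lebesgue"
proof -
  define T where "T n x = 1 / pi * hilbert_trunc f x (inverse (real (Suc n)))" for n x
  have T: "(\<lambda>x. lim (\<lambda>n. T n x)) \<in> borel_measurable lebesgue"
    unfolding T_def
    by (intro borel_measurable_lim_metric borel_measurable_times borel_measurable_const
        hilbert_trunc_measurable f)
  have "filterlim (\<lambda>n. inverse (real (Suc n))) (at_right 0) sequentially"
    by (intro tendsto_imp_filterlim_at_right LIMSEQ_inverse_real_of_nat) auto
  then have "(\<lambda>n. T n x) \<longlonglongrightarrow> hilbert f x" if "hilbert_defined f x" for x
    unfolding T_def by (rule filterlim_compose[OF hilbert_tendsto[OF that]])
  then have ae: "AE x in lebesgue. lim (\<lambda>n. T n x) = hilbert f x"
    using d by (auto elim!: eventually_mono intro: limI)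
  show ?thesis
  proof (rule measurableI)
    fix A :: "real set" assume A: "A \<in> sets borel"
    show "hilbert f -` A \<inter> space lebesgue \<in> sets lebesgue"
    proof (rule completion.in_sets_AE[OF _ measurable_sets[OF T A]])
      show "AE x in lebesgue. x \<in> (\<lambda>x. lim (\<lambda>n. T n x)) -` A \<inter> space lebesgue
          \<longleftrightarrow> x \<in> hilbert f -` A \<inter> space lebesgue"
        using ae by eventually_elim simp
    qed simp
  qed auto
qed

lemma hilbert_eqI:
  assumes "\<forall>\<^sub>F \<epsilon> in at_right 0. set_integrable lebesgue {y. \<bar>x - y\<bar> > \<epsilon>} (\<lambda>y. f y / (x - y))"
    and "((\<lambda>\<epsilon>. 1 / pi * hilbert_trunc f x \<epsilon>) \<longlongrightarrow> l) (at_right 0)"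
  shows "hilbert_defined f x" "hilbert f x = l"
proof -
  have "((\<lambda>\<epsilon>. pi * (1 / pi * hilbert_trunc f x \<epsilon>)) \<longlongrightarrow> pi * l) (at_right 0)"
    by (intro tendsto_mult tendsto_const assms(2))
  then have "(hilbert_trunc f x \<longlongrightarrow> pi * l) (at_right 0)" by simp
  with assms(1) show d: "hilbert_defined f x" by (auto simp: hilbert_defined_def)
  show "hilbert f x = l"
    using tendsto_unique[OF _ hilbert_tendsto[OF d] assms(2)] by simp
qed

text \<open>Since \<open>K\<close> is finite, one threshold for \<open>\<epsilon>\<close> makes all
  truncated integrals exist at once; they are added before passing to the limit.\<close>

lemma hilbert_sum:
  fixes f :: "'k \<Rightarrow> real \<Rightarrow> real" and s :: "'k \<Rightarrow> real"
  assumes K: "finite K" and d: "\<And>k. k \<in> K \<Longrightarrow> hilbert_defined (f k) x"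
  shows "hilbert (\<lambda>y. \<Sum>k\<in>K. s k * f k y) x = (\<Sum>k\<in>K. s k * hilbert (f k) x)"
proof -
  let ?S = "\<lambda>\<epsilon>. {y. \<bar>x - y\<bar> > \<epsilon>}"
  let ?f = "\<lambda>y. \<Sum>k\<in>K. s k * f k y"
  have ev: "\<forall>\<^sub>F \<epsilon> in at_right 0. \<forall>k\<in>K. set_integrable lebesgue (?S \<epsilon>) (\<lambda>y. f k y / (x - y))"
    using K d by (intro eventually_ball_finite) (auto simp: hilbert_defined_def)
  have eq: "indicator (?S \<epsilon>) y *\<^sub>R (?f y / (x - y))
      = (\<Sum>k\<in>K. s k * (indicator (?S \<epsilon>) y *\<^sub>R (f k y / (x - y))))" for y \<epsilon>
    by (simp add: sum_divide_distrib sum_distrib_left mult_ac)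
  have ev1: "\<forall>\<^sub>F \<epsilon> in at_right 0. set_integrable lebesgue (?S \<epsilon>) (\<lambda>y. ?f y / (x - y))"
    using ev
  proof eventually_elim
    case (elim \<epsilon>)
    then show ?case unfolding set_integrable_def eq
      by (intro Bochner_Integration.integrable_sum integrable_mult_right) auto
  qed
  have ev2: "\<forall>\<^sub>F \<epsilon> in at_right 0.
      (\<Sum>k\<in>K. s k * (1 / pi * hilbert_trunc (f k) x \<epsilon>)) = 1 / pi * hilbert_trunc ?f x \<epsilon>"
    using ev
  proof eventually_elim
    case (elim \<epsilon>)
    then have int: "integrable lebesgue (\<lambda>y. indicator (?S \<epsilon>) y *\<^sub>R (f k y / (x - y)))" if "k \<in> K" for k
      using that unfolding set_integrable_def by blast
    have "hilbert_trunc ?f x \<epsilon> = (\<Sum>k\<in>K. s k * hilbert_trunc (f k) x \<epsilon>)"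
      unfolding hilbert_trunc_def set_lebesgue_integral_def eq
      by (subst Bochner_Integration.integral_sum)
        (intro integrable_mult_right int, assumption, intro sum.cong refl integral_mult_right_zero)
    then show ?case by (simp add: sum_divide_distrib)
  qed
  have "((\<lambda>\<epsilon>. \<Sum>k\<in>K. s k * (1 / pi * hilbert_trunc (f k) x \<epsilon>))
      \<longlongrightarrow> (\<Sum>k\<in>K. s k * hilbert (f k) x)) (at_right 0)"
    by (intro tendsto_sum tendsto_mult tendsto_const hilbert_tendsto d)
  then show ?thesis
    by (intro hilbert_eqI[OF ev1]) (rule Lim_transform_eventually[OF _ ev2])
qed

text \<open>With all mass on one side of \<open>x\<close>, the kernel has the constant sign
  \<open>s\<close> and modulus at least \<open>1 / D\<close>, so nothing cancels. The gap
  \<open>\<delta>\<close> ensures that truncations with \<open>\<epsilon> < \<delta>\<close> remove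
  no mass.\<close>

lemma hilbert_one_sided_bound:
  fixes f :: "real \<Rightarrow> real"
  assumes d: "hilbert_defined f x" and s: "s = 1 \<or> s = - 1" and f: "integrable lebesgue f"
    and nn: "\<And>y. 0 \<le> f y" and \<delta>: "0 < \<delta>" and D: "0 < D"
    and supp: "\<And>y. f y \<noteq> 0 \<Longrightarrow> \<delta> < s * (x - y) \<and> s * (x - y) \<le> D"
  shows "(LINT y|lebesgue. f y) / (pi * D) \<le> s * hilbert f x"
proof -
  have "\<forall>\<^sub>F \<epsilon> in at_right (0::real). \<epsilon> < \<delta>"
    using \<delta> by (simp add: eventually_at_right_less order_tendstoD(2)[OF tendsto_ident_at])
  moreover have "\<forall>\<^sub>F \<epsilon> in at_right 0. set_integrable lebesgue {y. \<bar>x - y\<bar> > \<epsilon>} (\<lambda>y. f y / (x - y))"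
    using d by (auto simp: hilbert_defined_def)
  ultimately have "\<forall>\<^sub>F \<epsilon> in at_right 0.
      (LINT y|lebesgue. f y) / (pi * D) \<le> s * (1 / pi * hilbert_trunc f x \<epsilon>)"
  proof eventually_elim
    case (elim \<epsilon>)
    have "(LINT y|lebesgue. f y / D)
        \<le> (LINT y|lebesgue. s * (indicator {y. \<bar>x - y\<bar> > \<epsilon>} y *\<^sub>R (f y / (x - y))))"
    proof (rule integral_mono)
      show "integrable lebesgue (\<lambda>y. f y / D)" using f by simp
      show "integrable lebesgue (\<lambda>y. s * (indicator {y. \<bar>x - y\<bar> > \<epsilon>} y *\<^sub>R (f y / (x - y))))"
        using elim unfolding set_integrable_def by (intro integrable_mult_right)
      fix y
      show "f y / D \<le> s * (indicator {y. \<bar>x - y\<bar> > \<epsilon>} y *\<^sub>R (f y / (x - y)))"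
      proof (cases "f y = 0")
        case False
        have b: "\<delta> < s * (x - y)" "s * (x - y) \<le> D" using supp[OF False] by auto
        then have "\<bar>x - y\<bar> > \<epsilon>" using s elim by auto
        moreover have "f y / D \<le> f y / (s * (x - y))"
          using b \<delta> nn[of y] by (intro divide_left_mono) auto
        moreover have "f y / (s * (x - y)) = s * (f y / (x - y))"
          using s by (auto simp: minus_divide_right)
        ultimately show ?thesis by simp
      qed simp
    qed
    then have "(LINT y|lebesgue. f y) / D \<le> s * hilbert_trunc f x \<epsilon>"
      unfolding hilbert_trunc_def set_lebesgue_integral_def
      by (simp only: integral_mult_right_zero integral_divide_zero)
    then have "(LINT y|lebesgue. f y) / D / pi \<le> s * hilbert_trunc f x \<epsilon> / pi"
      by (intro divide_right_mono) auto
    then show ?case by (simp add: mult.commute)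
  qed
  moreover have "((\<lambda>\<epsilon>. s * (1 / pi * hilbert_trunc f x \<epsilon>)) \<longlongrightarrow> s * hilbert f x) (at_right 0)"
    by (intro tendsto_mult tendsto_const hilbert_tendsto d)
  ultimately show ?thesis
    by (intro tendsto_lowerbound) auto
qed

section \<open>Local integrability and infinite total mass\<close>

lemma AE_lebesgue_ex_in_interval:
  assumes "AE x in lebesgue. P x" "a < (b::real)"
  shows "\<exists>x\<in>{a<..<b}. P x"
proof (rule ccontr)
  assume "\<not> ?thesis"
  then have "AE x in lebesgue. x \<notin> {a<..<b}"
    using assms(1) by (auto elim!: eventually_mono)
  then have "{a<..<b} \<in> null_sets lebesgue"
    by (simp add: AE_iff_null_sets)
  then have "emeasure lebesgue {a<..<b} = 0" by blast
  with \<open>a < b\<close> show False by simp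
qed

text \<open>Existence of the transform at \<open>x\<close> includes integrability of
  \<open>f y / (x - y)\<close> off a small neighbourhood of \<open>x\<close>. On a bounded interval
  the denominator is at most \<open>B\<close> in modulus, so \<open>B\<close> times that function
  dominates \<open>f\<close>.\<close>

lemma hilbert_defined_imp_integrable_away:
  assumes d: "hilbert_defined f x" and \<delta>: "0 < \<delta>" and f[measurable]: "f \<in> borel_measurable lebesgue"
  shows "set_integrable lebesgue ({a..b} \<inter> {y. \<bar>x - y\<bar> > \<delta>}) f"
proof -
  have "\<forall>\<^sub>F \<epsilon> in at_right (0::real). \<epsilon> < \<delta>"
    using \<delta> by (simp add: order_tendstoD(2)[OF tendsto_ident_at])
  moreover have "\<forall>\<^sub>F \<epsilon> in at_right 0. set_integrable lebesgue {y. \<bar>x - y\<bar> > \<epsilon>} (\<lambda>y. f y / (x - y))"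
    using d by (auto simp: hilbert_defined_def)
  ultimately have "\<forall>\<^sub>F \<epsilon> in at_right 0. \<epsilon> < \<delta> \<and>
      set_integrable lebesgue {y. \<bar>x - y\<bar> > \<epsilon>} (\<lambda>y. f y / (x - y))"
    by eventually_elim simp
  then obtain \<epsilon> where \<epsilon>: "\<epsilon> < \<delta>" "set_integrable lebesgue {y. \<bar>x - y\<bar> > \<epsilon>} (\<lambda>y. f y / (x - y))"
    using eventually_happens'[of "at_right (0::real)"] by auto
  define B where "B = \<bar>x\<bar> + \<bar>a\<bar> + \<bar>b\<bar>"
  have "{y. \<bar>x - y\<bar> > \<delta>} \<in> sets lborel" by measurable
  then have [measurable]: "{y. \<bar>x - y\<bar> > \<delta>} \<in> sets lebesgue" by simp
  have [measurable]: "{a..b} \<in> sets lebesgue" by simp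
  show ?thesis unfolding set_integrable_def
  proof (rule Bochner_Integration.integrable_bound)
    show "integrable lebesgue (\<lambda>y. B * (indicator {y. \<bar>x - y\<bar> > \<epsilon>} y *\<^sub>R (f y / (x - y))))"
      using \<epsilon> unfolding set_integrable_def by (intro integrable_mult_right)
    show "AE y in lebesgue. norm (indicator ({a..b} \<inter> {y. \<bar>x - y\<bar> > \<delta>}) y *\<^sub>R f y)
        \<le> norm (B * (indicator {y. \<bar>x - y\<bar> > \<epsilon>} y *\<^sub>R (f y / (x - y))))"
    proof (rule AE_I2)
      fix y
      show "norm (indicator ({a..b} \<inter> {y. \<bar>x - y\<bar> > \<delta>}) y *\<^sub>R f y)
        \<le> norm (B * (indicator {y. \<bar>x - y\<bar> > \<epsilon>} y *\<^sub>R (f y / (x - y))))"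
      proof (cases "y \<in> {a..b} \<and> \<bar>x - y\<bar> > \<delta>")
        case True
        then have "\<bar>x - y\<bar> \<le> \<bar>B\<bar>" unfolding B_def by auto
        then have "\<bar>f y\<bar> * \<bar>x - y\<bar> \<le> \<bar>f y\<bar> * \<bar>B\<bar>" by (intro mult_left_mono) auto
        then show ?thesis using True \<epsilon> \<delta> by (auto simp: abs_mult field_simps)
      qed (auto simp: indicator_def)
    qed
  qed measurable
qed

text \<open>The transform exists at two points more than 1 apart. Each of them gives integrability
  off its neighbourhood of radius 1/4, and the two neighbourhoods are disjoint.\<close>

lemma in_lorentz_locally_integrable:
  assumes H: "hilbert_bounded p u w" and L: "in_lorentz p u w f"
  shows "set_integrable lebesgue {a..b} f"
proof -
  have ae: "AE x in lebesgue. hilbert_defined f x" using H L by (auto simp: hilbert_bounded_def)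
  have [measurable]: "f \<in> borel_measurable lebesgue" using L by (auto simp: in_lorentz_def)
  obtain x1 where x1: "x1 \<in> {0<..<1}" "hilbert_defined f x1"
    using AE_lebesgue_ex_in_interval[OF ae, of 0 1] by auto
  obtain x2 where x2: "x2 \<in> {2<..<3}" "hilbert_defined f x2"
    using AE_lebesgue_ex_in_interval[OF ae, of 2 3] by auto
  let ?S = "\<lambda>x. {a..b} \<inter> {y. \<bar>x - y\<bar> > 1/4}"
  have "set_integrable lebesgue (?S x1 \<union> ?S x2) f"
    using x1 x2 hilbert_defined_imp_integrable_away[of f _ "1/4" a b]
    by (intro set_integrable_Un) (auto simp: set_integrable_def)
  moreover have "?S x1 \<union> ?S x2 = {a..b}" using x1 x2 by (auto simp: abs_if)
  ultimately show ?thesis by simp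
qed

text \<open>The kernel decays like \<open>1 / y\<close> at infinity, so already the truncated
  integrals diverge logarithmically.\<close>

lemma not_hilbert_defined_one: "\<not> hilbert_defined (\<lambda>y. 1) x"
proof
  assume d: "hilbert_defined (\<lambda>y. 1) x"
  then have "\<forall>\<^sub>F \<epsilon> in at_right 0. set_integrable lebesgue {y. \<bar>x - y\<bar> > \<epsilon>} (\<lambda>y. 1 / (x - y))"
    by (auto simp: hilbert_defined_def)
  moreover have "\<forall>\<^sub>F \<epsilon> in at_right (0::real). 0 < \<epsilon>" by (simp add: eventually_at_right_less)
  ultimately have "\<forall>\<^sub>F \<epsilon> in at_right 0. 0 < \<epsilon> \<and>
      set_integrable lebesgue {y. \<bar>x - y\<bar> > \<epsilon>} (\<lambda>y. 1 / (x - y))"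
    by eventually_elim simp
  then obtain \<epsilon> where \<epsilon>: "0 < \<epsilon>"
    and int: "set_integrable lebesgue {y. \<bar>x - y\<bar> > \<epsilon>} (\<lambda>y. 1 / (x - y))"
    using eventually_happens'[of "at_right (0::real)"] by auto
  define B where "B = (LINT y|lebesgue. \<bar>indicator {y. \<bar>x - y\<bar> > \<epsilon>} y *\<^sub>R (1 / (x - y))\<bar>)"
  have B0: "0 \<le> B" unfolding B_def by simp
  \<comment> \<open>\<open>N\<close> makes the integral of \<open>1 / (y - x)\<close> over
    \<open>?I\<close> equal to \<open>ln (N / (2 * \<epsilon>)) = B + 1\<close>, more than the full
    absolute integral \<open>B\<close>. The factor 2 keeps \<open>?I\<close> inside the region
    beyond \<open>\<epsilon>\<close>.\<close>
  define N where "N = 2 * \<epsilon> * exp (B + 1)"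
  have N: "2 * \<epsilon> \<le> N" using B0 \<epsilon> by (simp add: N_def)
  let ?I = "{x + 2 * \<epsilon>..x + N}"
  have sub: "set_integrable lebesgue ?I (\<lambda>y. 1 / (x - y))"
    using \<epsilon> by (intro set_integrable_subset[OF int]) auto
  have "((\<lambda>y. 1 / (x - y)) has_integral (- ln (x + N - x) - (- ln (x + 2 * \<epsilon> - x)))) ?I"
  proof (rule fundamental_theorem_of_calculus)
    show "x + 2 * \<epsilon> \<le> x + N" using N by simp
    fix y assume "y \<in> ?I"
    then have "0 < y - x" using \<epsilon> by auto
    then show "((\<lambda>y. - ln (y - x)) has_vector_derivative 1 / (x - y)) (at y within ?I)"
      unfolding has_real_derivative_iff_has_vector_derivative[symmetric]
      by (auto intro!: derivative_eq_intros simp: field_simps)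
  qed
  then have "integral ?I (\<lambda>y. 1 / (x - y)) = ln (2 * \<epsilon>) - ln N"
    by (auto dest: integral_unique)
  also have "\<dots> = - (B + 1)" unfolding N_def using \<epsilon> by (simp add: ln_mult)
  finally have "(LINT y:?I|lebesgue. 1 / (x - y)) = - (B + 1)"
    using set_lebesgue_integral_eq_integral(2)[OF sub] by simp
  moreover have "(LINT y|lebesgue. - (indicator ?I y *\<^sub>R (1 / (x - y)))) \<le> B"
    unfolding B_def
  proof (rule integral_mono)
    show "integrable lebesgue (\<lambda>y. - (indicator ?I y *\<^sub>R (1 / (x - y))))"
      using sub unfolding set_integrable_def by (rule Bochner_Integration.integrable_minus)
    show "integrable lebesgue (\<lambda>y. \<bar>indicator {y. \<bar>x - y\<bar> > \<epsilon>} y *\<^sub>R (1 / (x - y))\<bar>)"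
      using int unfolding set_integrable_def by (rule integrable_abs)
    fix y
    show "- (indicator ?I y *\<^sub>R (1 / (x - y))) \<le> \<bar>indicator {y. \<bar>x - y\<bar> > \<epsilon>} y *\<^sub>R (1 / (x - y))\<bar>"
      using \<epsilon> by (auto simp: indicator_def minus_divide_right)
  qed
  ultimately show False unfolding set_lebesgue_integral_def by simp
qed

lemma hilbert_bounded_imp_umeas_UNIV:
  assumes p: "0 < p" and w: "weight_pos w" and H: "hilbert_bounded p u w"
  shows "umeas u UNIV = \<infinity>"
proof (rule ccontr)
  assume fin: "umeas u UNIV \<noteq> \<infinity>"
  \<comment> \<open>Adding 1 makes \<open>s\<close> positive, as
    \<open>lorentz_norm_indicator_le\<close> demands.\<close>
  define s where "s = enn2real (umeas u UNIV) + 1"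
  have s: "0 < s" by (simp add: s_def add_nonneg_pos)
  have "umeas u UNIV \<le> ennreal s"
    using fin unfolding s_def by (metis ennreal_enn2real_if ennreal_leI infinity_ennreal_def le_add_same_cancel1 zero_le_one)
  from lorentz_norm_indicator_le[OF p w this s]
  have "lorentz_norm p u w (\<lambda>x. ennreal \<bar>1\<bar>) < \<infinity>"
    by (simp add: le_less_trans)
  then have "in_lorentz p u w (\<lambda>x. 1)" by (simp add: in_lorentz_def)
  then have "AE x in lebesgue. hilbert_defined (\<lambda>x. 1) x" using H by (auto simp: hilbert_bounded_def)
  from AE_lebesgue_ex_in_interval[OF this, of 0 1] show False
    using not_hilbert_defined_one by auto
qed

section \<open>Choosing signs\<close>

text \<open>A set \<open>A\<close> encodes the choice with sign plus exactly on \<open>A\<close>.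
  The involution \<open>T\<close> flips the sign at \<open>j\<close> and changes the sum by
  \<open>2 * \<bar>h j\<bar> \<ge> 2 * c\<close>, so of \<open>A\<close> and \<open>T A\<close> at
  least one gives a sum of modulus at least \<open>c\<close>.\<close>

lemma card_signs_large_sum:
  fixes h :: "'k \<Rightarrow> real"
  assumes K: "finite K" and j: "j \<in> K" "c \<le> \<bar>h j\<bar>"
  shows "card (Pow K) \<le> 2 * card {A \<in> Pow K. c \<le> \<bar>\<Sum>k\<in>K. (if k \<in> A then 1 else - 1) * h k\<bar>}"
proof -
  define s where "s A = (\<Sum>k\<in>K. (if k \<in> A then 1 else - 1) * h k)" for A
  define G where "G = {A \<in> Pow K. c \<le> \<bar>s A\<bar>}"
  define T where "T A = (if j \<in> A then A - {j} else insert j A)" for A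
  have "Pow K \<subseteq> G \<union> T ` G"
  proof
    fix A assume A: "A \<in> Pow K"
    have split: "s B = (if j \<in> B then 1 else - 1) * h j + (\<Sum>k\<in>K - {j}. (if k \<in> B then 1 else - 1) * h k)" for B
      unfolding s_def by (rule sum.remove[OF K j(1)])
    have "(\<Sum>k\<in>K - {j}. (if k \<in> T A then 1 else - 1) * h k) = (\<Sum>k\<in>K - {j}. (if k \<in> A then 1 else - 1) * h k)"
      by (intro sum.cong) (auto simp: T_def)
    moreover have "j \<in> T A \<longleftrightarrow> j \<notin> A" by (auto simp: T_def)
    ultimately have "\<bar>s A - s (T A)\<bar> = 2 * \<bar>h j\<bar>" using split[of A] split[of "T A"] by auto
    then have "c \<le> \<bar>s A\<bar> \<or> c \<le> \<bar>s (T A)\<bar>" using j(2) by linarith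
    moreover have "T A \<in> Pow K" using A j(1) by (auto simp: T_def)
    moreover have "A = T (T A)" by (auto simp: T_def)
    ultimately show "A \<in> G \<union> T ` G" using A unfolding G_def by blast
  qed
  moreover have fin: "finite G" using K by (auto simp: G_def)
  ultimately have "card (Pow K) \<le> card (G \<union> T ` G)" by (intro card_mono) auto
  also have "\<dots> \<le> card G + card (T ` G)" by (rule card_Un_le)
  also have "\<dots> \<le> 2 * card G" using card_image_le[OF fin, of T] by simp
  finally show ?thesis by (simp add: G_def s_def)
qed

text \<open>Averaging: almost every point of \<open>S\<close> lies in at least half of the sets
  \<open>G A\<close>, so the measures of all \<open>G A\<close> add up to at least half of
  \<open>card (Pow K) * umeas u S\<close>. If each were at most \<open>t\<close>, then
  \<open>umeas u S\<close> would be at most \<open>2 * t\<close>.\<close>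

lemma exists_signs_large_umeas:
  fixes h :: "'k \<Rightarrow> real \<Rightarrow> real"
  assumes u: "weight_R u" and K: "finite K" and h[measurable]: "\<And>k. k \<in> K \<Longrightarrow> h k \<in> borel_measurable lebesgue"
    and Sm: "S \<in> sets lebesgue" and S: "AE x in lebesgue. x \<in> S \<longrightarrow> (\<exists>k\<in>K. c \<le> \<bar>h k x\<bar>)"
    and t: "2 * ennreal t < umeas u S"
  shows "\<exists>A\<subseteq>K. ennreal t < umeas u {x. c \<le> \<bar>\<Sum>k\<in>K. (if k \<in> A then 1 else - 1) * h k x\<bar>}"
proof (rule ccontr)
  assume contra: "\<not> ?thesis"
  have [measurable]: "u \<in> borel_measurable lebesgue" by (rule weight_R_measurable[OF u])
  define G where "G A = {x. c \<le> \<bar>\<Sum>k\<in>K. (if k \<in> A then 1 else - 1) * h k x\<bar>}" for A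
  have G[measurable]: "G A \<in> sets lebesgue" for A
  proof -
    have "(\<lambda>x. \<bar>\<Sum>k\<in>K. (if k \<in> A then 1 else - 1) * h k x\<bar>) \<in> borel_measurable lebesgue"
      by measurable
    then have "{x \<in> space lebesgue. c \<le> \<bar>\<Sum>k\<in>K. (if k \<in> A then 1 else - 1) * h k x\<bar>} \<in> sets lebesgue"
      by measurable
    then show ?thesis by (simp add: G_def)
  qed
  let ?N = "of_nat (card (Pow K)) :: ennreal"
  have "?N * umeas u S \<le> (\<integral>\<^sup>+ x. 2 * (\<Sum>A\<in>Pow K. ennreal (u x) * indicator (G A) x) \<partial>lebesgue)"
    (is "_ \<le> ?R")
  proof -
    have "?N * umeas u S \<le> (\<integral>\<^sup>+ x. ?N * (ennreal (u x) * indicator S x) \<partial>lebesgue)"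
      unfolding umeas_def using Sm by (subst nn_integral_cmult) auto
    also have "\<dots> \<le> ?R"
    proof (rule nn_integral_mono_AE)
      show "AE x in lebesgue. ?N * (ennreal (u x) * indicator S x)
          \<le> 2 * (\<Sum>A\<in>Pow K. ennreal (u x) * indicator (G A) x)"
        using S
      proof eventually_elim
        case (elim x)
        show ?case
        proof (cases "x \<in> S")
          case True
          with elim obtain j where j: "j \<in> K" "c \<le> \<bar>h j x\<bar>" by auto
          have "(\<Sum>A\<in>Pow K. indicator (G A) x :: ennreal) = (\<Sum>A\<in>{A \<in> Pow K. x \<in> G A}. 1)"
            using K by (intro sum.mono_neutral_cong_right) (auto simp: indicator_def)
          also have "\<dots> = of_nat (card {A \<in> Pow K. x \<in> G A})" by simp
          finally have eq: "(\<Sum>A\<in>Pow K. indicator (G A) x :: ennreal) = of_nat (card {A \<in> Pow K. x \<in> G A})" .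
          have "?N \<le> of_nat (2 * card {A \<in> Pow K. x \<in> G A})"
            using card_signs_large_sum[of K j c "\<lambda>k. h k x", OF K j]
            by (intro of_nat_mono) (simp add: G_def)
          also have "\<dots> = 2 * (\<Sum>A\<in>Pow K. indicator (G A) x)" unfolding eq by simp
          finally have "ennreal (u x) * ?N \<le> ennreal (u x) * (2 * (\<Sum>A\<in>Pow K. indicator (G A) x))"
            by (rule mult_left_mono) simp
          also have "\<dots> = 2 * (\<Sum>A\<in>Pow K. ennreal (u x) * indicator (G A) x)"
            by (simp add: sum_distrib_left mult_ac)
          finally show ?thesis using True by (simp add: mult.commute)
        qed simp
      qed
    qed
    finally show ?thesis .
  qed
  also have "?R = 2 * (\<Sum>A\<in>Pow K. umeas u (G A))"
    unfolding umeas_def by (subst nn_integral_cmult) (auto simp: nn_integral_sum)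
  also have "\<dots> \<le> 2 * (\<Sum>A\<in>Pow K. ennreal t)"
    using contra by (intro mult_left_mono sum_mono) (auto simp: G_def not_less)
  also have "\<dots> = ?N * (2 * ennreal t)" by (simp add: mult_ac)
  finally have "?N * umeas u S \<le> ?N * (2 * ennreal t)" .
  moreover have "0 < card (Pow K)" using K by (simp add: card_Pow)
  ultimately have "umeas u S \<le> 2 * ennreal t"
    by (subst (asm) ennreal_mult_le_mult_iff) (auto simp: of_nat_eq_0_iff)
  with t show False by auto
qed

text \<open>The signed sum \<open>g\<close> of the pieces satisfies
  \<open>\<bar>g\<bar> \<le> \<bar>f\<bar>\<close> because the sets \<open>E k\<close> are disjoint,
  so its norm does not exceed that of \<open>f\<close>. For a good choice of signs its transform is
  at least \<open>c\<close> in modulus on a set of measure above \<open>t\<close>.\<close>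

lemma hilbert_bounded_pieces:
  fixes E :: "'k \<Rightarrow> real set"
  assumes p: "0 < p" and u: "weight_R u"
    and H: "\<And>g. in_lorentz p u w g \<Longrightarrow> (AE x in lebesgue. hilbert_defined g x) \<and>
        weak_lorentz_norm p u w (\<lambda>x. ennreal \<bar>hilbert g x\<bar>)
          \<le> ennreal C * lorentz_norm p u w (\<lambda>x. ennreal \<bar>g x\<bar>)"
    and f: "in_lorentz p u w f" and K: "finite K"
    and E[measurable]: "\<And>k. k \<in> K \<Longrightarrow> E k \<in> sets lebesgue" and dj: "disjoint_family_on E K"
    and Sm: "S \<in> sets lebesgue" and S: "AE x in lebesgue. x \<in> S \<longrightarrow> (\<exists>k\<in>K. c \<le> \<bar>hilbert (\<lambda>y. indicator (E k) y * f y) x\<bar>)"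
    and c: "0 \<le> c" and t: "0 < t" "2 * ennreal t < umeas u S"
  shows "ennreal c * ennreal (Wfun w t powr (1 / p)) \<le> ennreal C * lorentz_norm p u w (\<lambda>x. ennreal \<bar>f x\<bar>)"
proof -
  have fm[measurable]: "f \<in> borel_measurable lebesgue" using f by (auto simp: in_lorentz_def)
  define F where "F k = (\<lambda>y. indicator (E k) y * f y)" for k
  have Fm[measurable]: "F k \<in> borel_measurable lebesgue" if "k \<in> K" for k
    using E[OF that] unfolding F_def by measurable
  have FL: "in_lorentz p u w (F k)" if "k \<in> K" for k
    using Fm[OF that] by (rule in_lorentz_mono[OF f _ _ p]) (auto simp: F_def indicator_def)
  have dF: "AE x in lebesgue. \<forall>k\<in>K. hilbert_defined (F k) x"
    using H FL K by (subst AE_finite_all) auto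
  have "hilbert (F k) \<in> borel_measurable lebesgue" if "k \<in> K" for k
    using H[OF FL[OF that]] Fm[OF that] by (intro hilbert_measurable) auto
  then obtain A where A: "ennreal t < umeas u {x. c \<le> \<bar>\<Sum>k\<in>K. (if k \<in> A then 1 else - 1) * hilbert (F k) x\<bar>}"
    using exists_signs_large_umeas[OF u K, of "\<lambda>k. hilbert (F k)" S c t] Sm S[folded F_def] t(2) by auto
  define g where "g y = (\<Sum>k\<in>K. (if k \<in> A then 1 else - 1) * F k y)" for y
  have g_le: "\<bar>g y\<bar> \<le> \<bar>f y\<bar>" for y
  proof -
    have "\<bar>g y\<bar> \<le> (\<Sum>k\<in>K. \<bar>(if k \<in> A then 1 else - 1) * F k y\<bar>)"
      unfolding g_def by (rule sum_abs)
    also have "\<dots> = (\<Sum>k\<in>K. indicator (E k) y * \<bar>f y\<bar>)"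
      by (intro sum.cong) (auto simp: F_def abs_mult)
    also have "\<dots> = indicator (\<Union>(E ` K)) y * \<bar>f y\<bar>"
      by (simp add: indicator_UN_disjoint[OF K dj] sum_distrib_right)
    also have "\<dots> \<le> \<bar>f y\<bar>" by (simp add: indicator_def)
    finally show ?thesis .
  qed
  have gm: "g \<in> borel_measurable lebesgue" unfolding g_def by measurable
  have gL: "in_lorentz p u w g" using g_le by (intro in_lorentz_mono[OF f gm _ p])
  have "umeas u {x. c \<le> \<bar>\<Sum>k\<in>K. (if k \<in> A then 1 else - 1) * hilbert (F k) x\<bar>}
      \<le> umeas u {x. ennreal c \<le> ennreal \<bar>hilbert g x\<bar>}"
  proof (rule umeas_mono_AE)
    show "AE x in lebesgue. x \<in> {x. c \<le> \<bar>\<Sum>k\<in>K. (if k \<in> A then 1 else - 1) * hilbert (F k) x\<bar>}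
        \<longrightarrow> x \<in> {x. ennreal c \<le> ennreal \<bar>hilbert g x\<bar>}"
      using dF
    proof eventually_elim
      case (elim x)
      then have "hilbert g x = (\<Sum>k\<in>K. (if k \<in> A then 1 else - 1) * hilbert (F k) x)"
        unfolding g_def by (intro hilbert_sum[OF K]) auto
      then show ?case by (auto intro!: ennreal_leI)
    qed
  qed
  with A have "ennreal t < umeas u {x. ennreal c \<le> ennreal \<bar>hilbert g x\<bar>}" by (rule less_le_trans)
  then have "ennreal c \<le> dec_rearr u (\<lambda>x. ennreal \<bar>hilbert g x\<bar>) t" by (rule dec_rearr_ge[OF _ c])
  then have "ennreal c * ennreal (Wfun w t powr (1 / p))
      \<le> dec_rearr u (\<lambda>x. ennreal \<bar>hilbert g x\<bar>) t * ennreal (Wfun w t powr (1 / p))"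
    by (rule mult_right_mono) simp
  also have "\<dots> \<le> weak_lorentz_norm p u w (\<lambda>x. ennreal \<bar>hilbert g x\<bar>)"
    unfolding weak_lorentz_norm_def using t(1) by (intro SUP_upper) auto
  also have "\<dots> \<le> ennreal C * lorentz_norm p u w (\<lambda>x. ennreal \<bar>g x\<bar>)" using H[OF gL] by blast
  also have "\<dots> \<le> ennreal C * lorentz_norm p u w (\<lambda>x. ennreal \<bar>f x\<bar>)"
    using g_le by (intro mult_left_mono lorentz_norm_mono p ennreal_leI) auto
  finally show ?thesis .
qed

section \<open>Weak bound on dilates of disjoint intervals\<close>

lemma set_integral_intermediate_value:
  fixes f :: "real \<Rightarrow> real"
  assumes f: "set_integrable lebesgue {a..b} f" and ab: "a \<le> b"
    and v: "0 \<le> v" "v \<le> (LINT x:{a..b}|lebesgue. f x)"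
  obtains m where "a \<le> m" "m \<le> b" "(LINT x:{a..m}|lebesgue. f x) = v"
proof -
  have eq: "(LINT x:{a..m}|lebesgue. f x) = integral {a..m} f" if "m \<le> b" for m
    using that by (intro set_lebesgue_integral_eq_integral(2) set_integrable_subset[OF f]) auto
  have "continuous_on {a..b} (\<lambda>x. integral {a..x} f)"
    using set_lebesgue_integral_eq_integral(1)[OF f] by (rule indefinite_integral_continuous_1)
  then have "\<exists>m\<ge>a. m \<le> b \<and> integral {a..m} f = v"
    using v ab eq[of b] by (intro IVT') auto
  then show ?thesis using that eq by auto
qed

text \<open>Each half of an interval carries mass at least \<open>r i * l\<close>, and its points
  are within \<open>6 * r i\<close> of any point of the fivefold dilate. The half on the other side
  of the median thus has a transform of modulus at least
  \<open>r i * l / (pi * (6 * r i)) = l / (6 * pi)\<close>.\<close>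

lemma weak_bound_disjoint_intervals:
  fixes a r :: "'i \<Rightarrow> real"
  assumes p: "0 < p" and u: "weight_R u"
    and H: "\<And>g. in_lorentz p u w g \<Longrightarrow> (AE x in lebesgue. hilbert_defined g x) \<and>
        weak_lorentz_norm p u w (\<lambda>x. ennreal \<bar>hilbert g x\<bar>)
          \<le> ennreal C * lorentz_norm p u w (\<lambda>x. ennreal \<bar>g x\<bar>)"
    and f: "in_lorentz p u w f" and nn: "\<And>y. 0 \<le> f y"
    and loc: "\<And>a b. set_integrable lebesgue {a..b} f"
    and K: "finite K" and r: "\<And>i. i \<in> K \<Longrightarrow> 0 < r i"
    and dj: "disjoint_family_on (\<lambda>i. {a i - r i..a i + r i}) K"
    and avg: "\<And>i. i \<in> K \<Longrightarrow> 2 * r i * l \<le> (LINT y:{a i - r i..a i + r i}|lebesgue. f y)"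
    and l: "0 < l" and t: "0 < t" "2 * ennreal t < umeas u (\<Union>i\<in>K. {a i - 5 * r i..a i + 5 * r i})"
  shows "ennreal (l / (6 * pi)) * ennreal (Wfun w t powr (1 / p))
    \<le> ennreal C * lorentz_norm p u w (\<lambda>x. ennreal \<bar>f x\<bar>)"
proof -
  have fm[measurable]: "f \<in> borel_measurable lebesgue" using f by (auto simp: in_lorentz_def)
  have "\<forall>i\<in>K. \<exists>m. a i - r i \<le> m \<and> m \<le> a i + r i \<and>
      (LINT y:{a i - r i..m}|lebesgue. f y) = (LINT y:{a i - r i..a i + r i}|lebesgue. f y) / 2"
  proof
    fix i assume i: "i \<in> K"
    have "0 \<le> 2 * r i * l" using r[OF i] l by simp
    then have "0 \<le> (LINT y:{a i - r i..a i + r i}|lebesgue. f y)" using avg[OF i] by linarith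
    then show "\<exists>m. a i - r i \<le> m \<and> m \<le> a i + r i \<and>
      (LINT y:{a i - r i..m}|lebesgue. f y) = (LINT y:{a i - r i..a i + r i}|lebesgue. f y) / 2"
      using set_integral_intermediate_value[OF loc, of "a i - r i" "a i + r i"
          "(LINT y:{a i - r i..a i + r i}|lebesgue. f y) / 2"] r[OF i] by auto
  qed
  then obtain m where m: "\<And>i. i \<in> K \<Longrightarrow> a i - r i \<le> m i" "\<And>i. i \<in> K \<Longrightarrow> m i \<le> a i + r i"
    and half: "\<And>i. i \<in> K \<Longrightarrow>
      (LINT y:{a i - r i..m i}|lebesgue. f y) = (LINT y:{a i - r i..a i + r i}|lebesgue. f y) / 2"
    by metis
  \<comment> \<open>The Boolean selects the left or right half. The median belongs to the left one
    only, so that the halves are disjoint.\<close>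
  define E where "E = (\<lambda>(i, b). if b then {a i - r i..m i} else {m i<..a i + r i})"
  let ?F = "\<lambda>k y. indicator (E k) y * f y"
  have Em: "E k \<in> sets lebesgue" for k by (cases k) (auto simp: E_def)
  have Eint: "integrable lebesgue (?F k)" for k
  proof (cases k)
    case (Pair i b)
    \<comment> \<open>For \<open>i\<close> outside \<open>K\<close> the order of \<open>m i\<close>
      and the endpoints is unknown; \<open>min\<close> and \<open>max\<close> cover every
      case.\<close>
    have "set_integrable lebesgue (E k) f"
      by (rule set_integrable_subset[OF loc[of "min (a i - r i) (m i)" "max (a i + r i) (m i)"]])
        (auto simp: E_def Pair)
    then show ?thesis by (simp add: set_integrable_def)
  qed
  have mass: "r i * l \<le> (LINT y|lebesgue. ?F (i, b) y)" if i: "i \<in> K" for i b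
  proof -
    have "(LINT y:{a i - r i..a i + r i}|lebesgue. f y)
        = (LINT y:{a i - r i..m i}|lebesgue. f y) + (LINT y:{m i<..a i + r i}|lebesgue. f y)"
    proof -
      have "{a i - r i..a i + r i} = {a i - r i..m i} \<union> {m i<..a i + r i}" using m[OF i] by auto
      then show ?thesis
        using m[OF i] by (auto intro!: set_integral_Un set_integrable_subset[OF loc[of "a i - r i" "a i + r i"]])
    qed
    then have "(LINT y:E (i, b)|lebesgue. f y) = (LINT y:{a i - r i..a i + r i}|lebesgue. f y) / 2"
      using half[OF i] by (simp add: E_def)
    then show ?thesis using avg[OF i] by (simp add: set_lebesgue_integral_def)
  qed
  show ?thesis
  proof (rule hilbert_bounded_pieces[OF p u H f, of "K \<times> UNIV" E])
    show "finite (K \<times> (UNIV :: bool set))" using K by simp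
    have sub: "E (i, b) \<subseteq> {a i - r i..a i + r i}" if "i \<in> K" for i b
      using m[OF that] by (auto simp: E_def)
    show "disjoint_family_on E (K \<times> UNIV)"
      unfolding disjoint_family_on_def
    proof (intro ballI impI)
      fix k k' :: "'i \<times> bool" assume k: "k \<in> K \<times> UNIV" "k' \<in> K \<times> UNIV" "k \<noteq> k'"
      show "E k \<inter> E k' = {}"
      proof (cases "fst k = fst k'")
        case True
        with k show ?thesis by (auto simp: E_def split: prod.splits if_splits)
      next
        case False
        then have "{a (fst k) - r (fst k)..a (fst k) + r (fst k)} \<inter> {a (fst k') - r (fst k')..a (fst k') + r (fst k')} = {}"
          using disjoint_family_onD[OF dj, of "fst k" "fst k'"] k(1,2) by (simp add: mem_Times_iff)
        moreover have "E k \<subseteq> {a (fst k) - r (fst k)..a (fst k) + r (fst k)}"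
          using sub[of "fst k" "snd k"] k(1) by (simp add: mem_Times_iff)
        moreover have "E k' \<subseteq> {a (fst k') - r (fst k')..a (fst k') + r (fst k')}"
          using sub[of "fst k'" "snd k'"] k(2) by (simp add: mem_Times_iff)
        ultimately show ?thesis by blast
      qed
    qed
    have dF: "AE x in lebesgue. \<forall>k\<in>K \<times> UNIV. hilbert_defined (?F k) x"
    proof -
      have "AE x in lebesgue. hilbert_defined (?F k) x" for k
      proof -
        have "?F k \<in> borel_measurable lebesgue" using Em[of k] by measurable
        then have "in_lorentz p u w (?F k)"
          by (rule in_lorentz_mono[OF f _ _ p]) (auto simp: indicator_def)
        then show ?thesis using H by blast
      qed
      then show ?thesis using K by (subst AE_finite_all) auto
    qed
    \<comment> \<open>At a median itself neither half is at positive distance, so these finitely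
      many points are excluded.\<close>
    have ne: "AE x in lebesgue. \<forall>i\<in>K. x \<noteq> m i"
      using K by (subst AE_finite_all) (auto intro: AE_completion[OF AE_lborel_singleton])
    show "AE x in lebesgue. x \<in> (\<Union>i\<in>K. {a i - 5 * r i..a i + 5 * r i}) \<longrightarrow>
        (\<exists>k\<in>K \<times> UNIV. l / (6 * pi) \<le> \<bar>hilbert (?F k) x\<bar>)"
      using dF ne
    proof eventually_elim
      case (elim x)
      show ?case
      proof
        assume "x \<in> (\<Union>i\<in>K. {a i - 5 * r i..a i + 5 * r i})"
        then obtain i where i: "i \<in> K" and x: "a i - 5 * r i \<le> x" "x \<le> a i + 5 * r i" by auto
        \<comment> \<open>If \<open>x\<close> lies to the right of the median, the left half is used
          with \<open>s = 1\<close>; otherwise the right half with \<open>s = - 1\<close>.\<close>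
        define b where "b \<longleftrightarrow> m i < x"
        define s :: real where "s = (if b then 1 else - 1)"
        have "(LINT y|lebesgue. ?F (i, b) y) / (pi * (6 * r i)) \<le> s * hilbert (?F (i, b)) x"
        proof (rule hilbert_one_sided_bound[OF _ _ Eint])
          show "hilbert_defined (?F (i, b)) x" using elim i by auto
          show "s = 1 \<or> s = - 1" by (simp add: s_def)
          show "0 \<le> ?F (i, b) y" for y using nn by simp
          \<comment> \<open>The left half contains the median, so the full distance would not be a
            strict lower bound; half of it is.\<close>
          show "0 < s * (x - m i) / 2" using elim i by (auto simp: s_def b_def)
          show "0 < 6 * r i" using r[OF i] by simp
          show "s * (x - m i) / 2 < s * (x - y) \<and> s * (x - y) \<le> 6 * r i" if "?F (i, b) y \<noteq> 0" for y
          proof -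
            have "y \<in> E (i, b)" using that by (auto simp: indicator_def split: if_splits)
            then have "a i - r i \<le> y" "y \<le> a i + r i" "b \<longrightarrow> y \<le> m i" "\<not> b \<longrightarrow> m i < y"
              using m[OF i] by (auto simp: E_def split: if_splits)
            then show ?thesis using x by (cases b) (auto simp: s_def b_def)
          qed
        qed
        moreover have "l / (6 * pi) \<le> (LINT y|lebesgue. ?F (i, b) y) / (pi * (6 * r i))"
        proof -
          have "l / (6 * pi) = (r i * l) / (pi * (6 * r i))" using r[OF i] by simp
          also have "\<dots> \<le> (LINT y|lebesgue. ?F (i, b) y) / (pi * (6 * r i))"
            using mass[OF i] r[OF i] by (intro divide_right_mono) auto
          finally show ?thesis .
        qed
        moreover have "s * hilbert (?F (i, b)) x \<le> \<bar>hilbert (?F (i, b)) x\<bar>" by (auto simp: s_def)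
        ultimately have "l / (6 * pi) \<le> \<bar>hilbert (?F (i, b)) x\<bar>" by linarith
        with i show "\<exists>k\<in>K \<times> UNIV. l / (6 * pi) \<le> \<bar>hilbert (?F k) x\<bar>"
          by (intro bexI[of _ "(i, b)"]) auto
      qed
    qed
    show "(\<Union>i\<in>K. {a i - 5 * r i..a i + 5 * r i}) \<in> sets lebesgue"
      using K by (intro sets.finite_UN) auto
  qed (use Em l t in auto)
qed

section \<open>Doubling of W\<close>

lemma weight_R_bisect:
  assumes u: "weight_R u" and ab: "a \<le> b"
  obtains a' b' where "a \<le> a'" "a' \<le> b'" "b' \<le> b" "b' - a' = (b - a) / 2"
    "(LINT x:{a'..b'}|lebesgue. u x) \<le> (LINT x:{a..b}|lebesgue. u x) / 2"
proof -
  define c where "c = (a + b) / 2"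
  have c: "a \<le> c" "c \<le> b" "c - a = (b - a) / 2" "b - c = (b - a) / 2"
    using ab by (auto simp: c_def field_simps)
  have int: "set_integrable lebesgue {a..b} u" for a b using u by (auto simp: weight_R_def)
  note eq = set_lebesgue_integral_eq_integral[OF int]
  have "integral {a..c} u + integral {c..b} u = integral {a..b} u"
    using c eq(1) by (intro Henstock_Kurzweil_Integration.integral_combine) auto
  then have "integral {a..c} u \<le> integral {a..b} u / 2 \<or> integral {c..b} u \<le> integral {a..b} u / 2"
    by linarith
  then show ?thesis
  proof
    assume "integral {a..c} u \<le> integral {a..b} u / 2"
    then show ?thesis by (intro that[of a c]) (use c in \<open>simp_all add: eq(2)\<close>)
  next
    assume "integral {c..b} u \<le> integral {a..b} u / 2"
    then show ?thesis by (intro that[of c b]) (use c in \<open>simp_all add: eq(2)\<close>)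
  qed
qed

text \<open>The weak bound at level \<open>r\<close> is applied to the indicator of \<open>J\<close>
  and the single interval from \<open>a\<close> to \<open>b\<close>. The average is 1/8, which gives
  \<open>48 = 8 * 6\<close>, and \<open>umeas u J \<le> r / 2\<close> puts \<open>W\<close> at
  \<open>r / 2\<close> on the right.\<close>

lemma Wfun_doubling:
  assumes p: "0 < p" and u: "weight_R u" and w: "weight_pos w" and U: "umeas u UNIV = \<infinity>"
    and H: "\<And>g. in_lorentz p u w g \<Longrightarrow> (AE x in lebesgue. hilbert_defined g x) \<and>
        weak_lorentz_norm p u w (\<lambda>x. ennreal \<bar>hilbert g x\<bar>)
          \<le> ennreal C * lorentz_norm p u w (\<lambda>x. ennreal \<bar>g x\<bar>)"
    and C: "0 \<le> C" and r: "0 < r"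
  shows "Wfun w r powr (1 / p) \<le> 48 * pi * C * Wfun w (r / 2) powr (1 / p)"
proof -
  let ?\<nu> = "density lebesgue (\<lambda>x. ennreal (u x))"
  let ?U = "\<lambda>a b. LINT x:{a..b}|lebesgue. u x"
  have int: "set_integrable lebesgue {a..b} u" for a b using u by (auto simp: weight_R_def)
  have "x \<in> (\<Union>n::nat. {- real n..real n})" for x :: real
    using real_arch_simple[of "\<bar>x\<bar>"] by (auto simp: abs_le_iff) (metis minus_le_iff)
  then have cover: "(\<Union>n::nat. {- real n..real n}) = UNIV" by blast
  have "(SUP n::nat. emeasure ?\<nu> {- real n..real n}) = emeasure ?\<nu> (\<Union>n::nat. {- real n..real n})"
    by (intro SUP_emeasure_incseq) (auto simp: incseq_def)
  also have "\<dots> = \<infinity>" using U by (simp add: cover umeas_eq_emeasure[OF u])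
  finally have "ennreal (4 * r) < (SUP n::nat. emeasure ?\<nu> {- real n..real n})"
    by (simp only: infinity_ennreal_def ennreal_less_top)
  then obtain n :: nat where "ennreal (4 * r) < emeasure ?\<nu> {- real n..real n}"
    by (auto simp: less_SUP_iff)
  then have "ennreal (4 * r) < ennreal (?U (- real n) (real n))"
    by (simp add: umeas_eq_emeasure[OF u, symmetric] umeas_interval[OF u])
  then have "4 * r \<le> ?U (- real n) (real n)" using r by (simp add: ennreal_less_iff)
  \<comment> \<open>The mass \<open>4 * r\<close> exceeds the \<open>2 * r\<close> required at level
    \<open>r\<close>, and an eighth of it is \<open>r / 2\<close>.\<close>
  then obtain b where b: "- real n \<le> b" "?U (- real n) b = 4 * r"
    using r by (elim set_integral_intermediate_value[OF int, rotated 2]) auto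
  define a where "a = - real n"
  have "a \<noteq> b"
  proof
    assume "a = b"
    then have "?U (- real n) b = 0"
      using set_lebesgue_integral_eq_integral(2)[OF int, of b b] by (simp add: a_def)
    with b r show False by simp
  qed
  with b have ab: "a < b" "?U a b = 4 * r" by (auto simp: a_def)
  obtain a1 b1 where 1: "a \<le> a1" "a1 \<le> b1" "b1 \<le> b" "b1 - a1 = (b - a) / 2" "?U a1 b1 \<le> ?U a b / 2"
    using weight_R_bisect[OF u, of a b] ab by auto
  obtain a2 b2 where 2: "a1 \<le> a2" "a2 \<le> b2" "b2 \<le> b1" "b2 - a2 = (b1 - a1) / 2" "?U a2 b2 \<le> ?U a1 b1 / 2"
    using weight_R_bisect[OF u 1(2)] by auto
  obtain a3 b3 where 3: "a2 \<le> a3" "a3 \<le> b3" "b3 \<le> b2" "b3 - a3 = (b2 - a2) / 2" "?U a3 b3 \<le> ?U a2 b2 / 2"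
    using weight_R_bisect[OF u 2(2)] by auto
  define J where "J = {a3..b3}"
  have J: "J \<subseteq> {a..b}" "b3 - a3 = (b - a) / 8" using 1 2 3 by (auto simp: J_def)
  have "umeas u J \<le> ennreal (r / 2)"
    unfolding J_def umeas_interval[OF u] using 1 2 3 ab by (intro ennreal_leI) linarith
  then have norm: "lorentz_norm p u w (\<lambda>x. ennreal \<bar>indicator J x\<bar>) \<le> ennreal (Wfun w (r / 2) powr (1 / p))"
    using r by (intro lorentz_norm_indicator_le[OF p w]) auto
  have JL: "in_lorentz p u w (indicator J)"
    unfolding in_lorentz_def
  proof
    show "lorentz_norm p u w (\<lambda>x. ennreal \<bar>indicator J x\<bar>) < \<infinity>"
      by (rule le_less_trans[OF norm]) simp
    show "indicator J \<in> borel_measurable lebesgue" by (simp add: J_def borel_measurable_indicator)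
  qed
  have JI: "integrable lebesgue (indicator J :: real \<Rightarrow> real)"
    unfolding J_def using 3(2) by (intro integrable_real_indicator) simp_all
  define R where "R = (b - a) / 2"
  define m where "m = (a + b) / 2"
  have ab_eq: "m - R = a" "m + R = b" by (auto simp: m_def R_def field_simps)
  have R: "0 < R" using ab by (simp add: R_def)
  have "ennreal ((1 / 8) / (6 * pi)) * ennreal (Wfun w r powr (1 / p))
      \<le> ennreal C * lorentz_norm p u w (\<lambda>x. ennreal \<bar>indicator J x\<bar>)"
  proof (rule weak_bound_disjoint_intervals[OF p u H JL, where K = "{()}" and a = "\<lambda>_. m" and r = "\<lambda>_. R"])
    show "set_integrable lebesgue {c..d} (indicator J :: real \<Rightarrow> real)" for c d
      unfolding set_integrable_def using JI by (intro integrable_mult_indicator) auto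
    have "(LINT y:{a..b}|lebesgue. indicator J y) = (LINT y|lebesgue. indicator J y :: real)"
      unfolding set_lebesgue_integral_def using J(1)
      by (intro Bochner_Integration.integral_cong) (auto simp: indicator_def)
    also have "\<dots> = b3 - a3" using 3(2) by (simp add: J_def)
    finally show "2 * R * (1 / 8) \<le> (LINT y:{m - R..m + R}|lebesgue. indicator J y)"
      unfolding ab_eq using J(2) by (simp add: R_def)
    have "2 * ennreal r = ennreal (2 * r)" using r by (simp add: ennreal_mult)
    also have "\<dots> < ennreal (4 * r)" using r by (intro ennreal_lessI) auto
    also have "\<dots> = umeas u {a..b}" using ab by (simp add: umeas_interval[OF u])
    also have "\<dots> \<le> umeas u (\<Union>i\<in>{()}. {m - 5 * R..m + 5 * R})"
      using R ab_eq by (intro umeas_mono) auto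
    finally show "2 * ennreal r < umeas u (\<Union>i\<in>{()}. {m - 5 * R..m + 5 * R})" .
  qed (use R r in \<open>auto simp: disjoint_family_on_def\<close>)
  also have "\<dots> \<le> ennreal C * ennreal (Wfun w (r / 2) powr (1 / p))"
    using norm by (intro mult_left_mono) auto
  finally have "1 / 8 / (6 * pi) * Wfun w r powr (1 / p) \<le> C * Wfun w (r / 2) powr (1 / p)"
    using C by (simp add: ennreal_mult[symmetric])
  then show ?thesis by (simp add: field_simps)
qed

section \<open>Covering the superlevel sets of the maximal function\<close>

text \<open>The average over some closed interval containing \<open>x\<close> exceeds
  \<open>y\<close> strictly, which leaves room to enlarge it on both sides with average still at
  least \<open>y\<close>. Then \<open>x\<close> is interior even if it was an endpoint, and the
  cover consists of open balls.\<close>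

lemma maximal_superlevel_cover:
  assumes loc: "\<And>a b. set_integrable lebesgue {a..b} (\<lambda>x. \<bar>f x\<bar>)" and y: "0 < y"
  shows "{x. ennreal y < maximal f x} \<subseteq>
    (\<Union>(c, r)\<in>{(c, r). 0 < r \<and> 2 * r * y \<le> (LINT z:{c - r..c + r}|lebesgue. \<bar>f z\<bar>)}. ball c r)"
proof
  fix x assume "x \<in> {x. ennreal y < maximal f x}"
  then obtain a b where ab: "a \<le> x" "x \<le> b" "a < b"
    and avg: "ennreal y < (\<integral>\<^sup>+ z. ennreal \<bar>f z\<bar> * indicator {a..b} z \<partial>lebesgue) / ennreal (b - a)"
    by (auto simp: maximal_def less_SUP_iff)
  let ?I = "\<lambda>a b. LINT z:{a..b}|lebesgue. \<bar>f z\<bar>"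
  have I0: "0 \<le> ?I a b" unfolding set_lebesgue_integral_def by (intro integral_nonneg_AE) auto
  have "(\<integral>\<^sup>+ z. ennreal \<bar>f z\<bar> * indicator {a..b} z \<partial>lebesgue)
      = (\<integral>\<^sup>+ z. ennreal (indicator {a..b} z * \<bar>f z\<bar>) \<partial>lebesgue)"
    by (intro nn_integral_cong) (auto simp: indicator_def)
  also have "\<dots> = ennreal (?I a b)"
    using loc[of a b] by (auto simp: set_integrable_def set_lebesgue_integral_def intro!: nn_integral_eq_integral)
  finally have "ennreal y < ennreal (?I a b / (b - a))"
    using avg ab I0 by (simp add: divide_ennreal)
  then have "y < ?I a b / (b - a)" using y by (simp add: ennreal_less_iff)
  then have lt: "y * (b - a) < ?I a b" using ab by (simp add: field_simps)
  \<comment> \<open>The enlarged interval has length \<open>?I a b / y\<close>, so the mass on the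
    original one alone already gives average \<open>y\<close>.\<close>
  define \<delta> where "\<delta> = (?I a b / y - (b - a)) / 2"
  have \<delta>: "0 < \<delta>" using lt y by (simp add: \<delta>_def field_simps)
  define c where "c = (a + b) / 2"
  define r where "r = (b - a) / 2 + \<delta>"
  have cr: "c - r = a - \<delta>" "c + r = b + \<delta>" by (auto simp: c_def r_def field_simps)
  have "2 * r * y = ?I a b" using y by (simp add: r_def \<delta>_def field_simps)
  also have "\<dots> \<le> ?I (c - r) (c + r)"
    unfolding set_lebesgue_integral_def
  proof (rule integral_mono)
    show "indicator {a..b} z *\<^sub>R \<bar>f z\<bar> \<le> indicator {c - r..c + r} z *\<^sub>R \<bar>f z\<bar>" for z
      using \<delta> unfolding cr by (auto simp: indicator_def)
  qed (use loc in \<open>auto simp: set_integrable_def\<close>)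
  finally have "2 * r * y \<le> ?I (c - r) (c + r)" .
  moreover have "0 < r" using \<delta> ab by (simp add: r_def add_nonneg_pos)
  moreover have "x \<in> ball c r" using ab \<delta> cr by (auto simp: dist_real_def abs_if)
  ultimately show "x \<in> (\<Union>(c, r)\<in>{(c, r). 0 < r \<and> 2 * r * y \<le> ?I (c - r) (c + r)}. ball c r)"
    by blast
qed

text \<open>Lindelof reduces the cover to a countable one, continuity from below to a finite one of
  measure still above \<open>t\<close>. Its radii are bounded by a maximum, so the Vitali lemma
  selects disjoint closed balls whose fivefold dilates cover.\<close>

lemma finite_disjoint_subcover:
  fixes \<I> :: "(real \<times> real) set"
  assumes u: "weight_R u" and pos: "\<And>c r. (c, r) \<in> \<I> \<Longrightarrow> 0 < r"
    and t: "ennreal t < umeas u (\<Union>(c, r)\<in>\<I>. ball c r)"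
  obtains K where "finite K" "K \<subseteq> \<I>" "disjoint_family_on (\<lambda>i. {fst i - snd i..fst i + snd i}) K"
    "ennreal t < umeas u (\<Union>i\<in>K. {fst i - 5 * snd i..fst i + 5 * snd i})"
proof -
  let ?\<nu> = "density lebesgue (\<lambda>x. ennreal (u x))"
  define B where "B = (\<lambda>(c::real, r). ball c r)"
  have B: "open (B i)" for i by (simp add: B_def split_beta)
  then obtain F where F: "F \<subseteq> B ` \<I>" "countable F" "\<Union>F = \<Union>(B ` \<I>)"
    using Lindelof[of "B ` \<I>"] by (metis (no_types, lifting) imageE)
  then obtain J where J: "countable J" "J \<subseteq> \<I>" "F = B ` J"
    by (meson countable_subset_image)
  have t': "ennreal t < umeas u (\<Union>i\<in>J. B i)" using t F(3) J(3) by (simp add: B_def)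
  have "J \<noteq> {}" using t' by (auto simp: umeas_def)
  define G where "G n = (\<Union>i\<in>from_nat_into J ` {..n}. B i)" for n :: nat
  have G: "open (G n)" for n unfolding G_def by (intro open_UN ballI B)
  have "(\<Union>n. G n) = (\<Union>i\<in>range (from_nat_into J). B i)" unfolding G_def by auto
  then have "(\<Union>n. G n) = (\<Union>i\<in>J. B i)"
    by (simp only: range_from_nat_into[OF \<open>J \<noteq> {}\<close> J(1)])
  moreover have "(SUP n. emeasure ?\<nu> (G n)) = emeasure ?\<nu> (\<Union>n. G n)"
  proof (rule SUP_emeasure_incseq)
    show "incseq G" unfolding incseq_def G_def by (intro allI impI UN_mono image_mono) auto
  qed (use G in auto)
  moreover have "open (\<Union>i\<in>J. B i)" by (intro open_UN ballI B)
  ultimately have "ennreal t < (SUP n. emeasure ?\<nu> (G n))"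
    using t' by (simp add: umeas_eq_emeasure[OF u])
  then obtain n where n: "ennreal t < umeas u (G n)"
    using G by (auto simp: less_SUP_iff umeas_eq_emeasure[OF u])
  define K0 where "K0 = from_nat_into J ` {..n}"
  have K0: "finite K0" "K0 \<subseteq> \<I>"
    using from_nat_into[OF \<open>J \<noteq> {}\<close>] J(2) by (auto simp: K0_def)
  have rad: "0 < snd i \<and> snd i \<le> Max (snd ` K0)" if "i \<in> K0" for i
    using that K0 pos[of "fst i" "snd i"] by auto
  have "G n \<subseteq> (\<Union>i\<in>K0. cball (fst i) (snd i))"
    unfolding G_def K0_def B_def split_beta by (intro UN_mono ball_subset_cball) auto
  from this rad obtain K where K: "countable K" "K \<subseteq> K0"
      "pairwise (\<lambda>i j. disjnt (cball (fst i) (snd i)) (cball (fst j) (snd j))) K"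
      "G n \<subseteq> (\<Union>i\<in>K. cball (fst i) (5 * snd i))"
    by (rule Vitali_covering_lemma_cballs)
  show ?thesis
  proof
    show "finite K" "K \<subseteq> \<I>" using K(2) K0 finite_subset by auto
    show "disjoint_family_on (\<lambda>i. {fst i - snd i..fst i + snd i}) K"
      using K(3) by (auto simp: disjoint_family_on_def pairwise_def disjnt_def cball_eq_atLeastAtMost)
    have "umeas u (G n) \<le> umeas u (\<Union>i\<in>K. {fst i - 5 * snd i..fst i + 5 * snd i})"
      using K(4) by (intro umeas_mono) (simp add: cball_eq_atLeastAtMost)
    with n show "ennreal t < umeas u (\<Union>i\<in>K. {fst i - 5 * snd i..fst i + 5 * snd i})"
      by (rule less_le_trans)
  qed
qed

section \<open>From level sets to the weak-type bound for the maximal operator\<close>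

theorem theorem3p9:
  fixes p :: real and u w :: "real \<Rightarrow> real"
  assumes "p > 0" and "weight_R u" and "weight_pos w"
    and "hilbert_bounded p u w"
  shows "maximal_bounded p u w"
proof -
  note p = assms(1) and u = assms(2) and w = assms(3)
  obtain C0 where C0: "\<And>g. in_lorentz p u w g \<Longrightarrow> (AE x in lebesgue. hilbert_defined g x) \<and>
        weak_lorentz_norm p u w (\<lambda>x. ennreal \<bar>hilbert g x\<bar>)
          \<le> ennreal C0 * lorentz_norm p u w (\<lambda>x. ennreal \<bar>g x\<bar>)"
    using assms(4) by (auto simp: hilbert_bounded_def)
  \<comment> \<open>\<open>ennreal\<close> sends negative reals to 0, so this keeps the bound and
    makes the constant usable in real arithmetic.\<close>
  define C where "C = max 0 C0"
  have C: "0 \<le> C" by (simp add: C_def)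
  have "ennreal C = ennreal C0" by (simp add: C_def max_def ennreal_neg)
  with C0 have H: "\<And>g. in_lorentz p u w g \<Longrightarrow> (AE x in lebesgue. hilbert_defined g x) \<and>
        weak_lorentz_norm p u w (\<lambda>x. ennreal \<bar>hilbert g x\<bar>)
          \<le> ennreal C * lorentz_norm p u w (\<lambda>x. ennreal \<bar>g x\<bar>)" by simp
  note U = hilbert_bounded_imp_umeas_UNIV[OF p w assms(4)]
  define V where "V t = Wfun w t powr (1 / p)" for t
  \<comment> \<open>The first factor comes from \<open>Wfun_doubling\<close>, the second from the
    weak bound with \<open>l = y\<close>.\<close>
  define D where "D = (48 * pi * C) * (6 * pi * C)"
  have D: "0 \<le> D" using C by (simp add: D_def)
  have "weak_lorentz_norm p u w (maximal f) \<le> ennreal D * lorentz_norm p u w (\<lambda>x. ennreal \<bar>f x\<bar>)"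
    if f: "in_lorentz p u w f" for f
  proof -
    have fm: "(\<lambda>x. \<bar>f x\<bar>) \<in> borel_measurable lebesgue" using f by (auto simp: in_lorentz_def)
    have fL: "in_lorentz p u w (\<lambda>x. \<bar>f x\<bar>)" by (rule in_lorentz_mono[OF f fm _ p]) auto
    note loc = in_lorentz_locally_integrable[OF assms(4) fL]
    obtain N where N: "lorentz_norm p u w (\<lambda>x. ennreal \<bar>f x\<bar>) = ennreal N" "0 \<le> N"
      using f by (cases "lorentz_norm p u w (\<lambda>x. ennreal \<bar>f x\<bar>)") (auto simp: in_lorentz_def)
    have level: "y * V t \<le> D * N" if y: "0 < y" "ennreal y < dec_rearr u (maximal f) t" and t: "0 < t" for y t
    proof -
      let ?I = "{(c, r). 0 < r \<and> 2 * r * y \<le> (LINT z:{c - r..c + r}|lebesgue. \<bar>f z\<bar>)}"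
      have "ennreal t < umeas u {x. ennreal y < maximal f x}"
      proof (rule ccontr)
        assume "\<not> ?thesis"
        then have "dec_rearr u (maximal f) t \<le> ennreal y"
          unfolding dec_rearr_def using y(1) by (intro Inf_lower imageI) auto
        with y(2) show False by simp
      qed
      also have "\<dots> \<le> umeas u (\<Union>(c, r)\<in>?I. ball c r)"
        by (intro umeas_mono maximal_superlevel_cover loc y)
      finally have gt: "ennreal t < umeas u (\<Union>(c, r)\<in>?I. ball c r)" .
      obtain K where K: "finite K" "K \<subseteq> ?I" "disjoint_family_on (\<lambda>i. {fst i - snd i..fst i + snd i}) K"
        "ennreal t < umeas u (\<Union>i\<in>K. {fst i - 5 * snd i..fst i + 5 * snd i})"
        by (rule finite_disjoint_subcover[OF u _ gt]) auto
      \<comment> \<open>The choice of signs costs half of the measure, so the dilates, of measure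
        above \<open>t\<close>, give the bound at \<open>t / 2\<close>; doubling then restores
        \<open>V t\<close>.\<close>
      have t2: "2 * ennreal (t / 2) = ennreal t" using t ennreal_mult[of 2 "t / 2"] by simp
      have "ennreal (y / (6 * pi)) * ennreal (V (t / 2))
          \<le> ennreal C * lorentz_norm p u w (\<lambda>x. ennreal \<bar>\<bar>f x\<bar>\<bar>)"
        unfolding V_def
        by (rule weak_bound_disjoint_intervals[OF p u H fL _ loc K(1) _ K(3)])
          (use K t y in \<open>auto simp: t2 split_beta\<close>)
      then have "y / (6 * pi) * V (t / 2) \<le> C * N"
        using C N y by (simp add: ennreal_mult[symmetric] V_def)
      then have "y * V (t / 2) \<le> 6 * pi * C * N" by (simp add: field_simps)
      then have "(48 * pi * C) * (y * V (t / 2)) \<le> (48 * pi * C) * (6 * pi * C * N)"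
        using C by (intro mult_left_mono) auto
      moreover have "y * V t \<le> y * (48 * pi * C * V (t / 2))"
        unfolding V_def using y by (intro mult_left_mono Wfun_doubling[OF p u w U H C t]) auto
      ultimately show ?thesis by (simp add: D_def mult_ac)
    qed
    show ?thesis
      unfolding weak_lorentz_norm_def
    proof (rule SUP_least)
      fix t :: real assume "t \<in> {0<..}"
      then have t: "0 < t" by simp
      show "dec_rearr u (maximal f) t * ennreal (Wfun w t powr (1 / p))
          \<le> ennreal D * lorentz_norm p u w (\<lambda>x. ennreal \<bar>f x\<bar>)"
      \<comment> \<open>If \<open>V t = 0\<close> the rearrangement may be infinite, but in
        \<open>ennreal\<close> the product is still 0. Otherwise division by \<open>V t\<close> is
        possible.\<close>
      proof (cases "V t = 0")
        case True
        then show ?thesis by (simp add: V_def)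
      next
        case False
        then have Vt: "0 < V t" by (simp add: V_def)
        have "dec_rearr u (maximal f) t \<le> ennreal (D * N / V t)"
        proof (rule ccontr)
          assume "\<not> ?thesis"
          then obtain z where z: "ennreal (D * N / V t) < z" "z < dec_rearr u (maximal f) t"
            using dense by (metis not_le)
          then obtain y where y: "z = ennreal y" "0 \<le> y"
            by (cases z) auto
          have "0 \<le> D * N / V t" using D N Vt by simp
          then have lt: "D * N / V t < y" using z(1) y by (simp add: ennreal_less_iff)
          then have "0 < y" using \<open>0 \<le> D * N / V t\<close> by linarith
          with level z(2) y t have "y * V t \<le> D * N" by blast
          with lt Vt show False by (simp add: field_simps)
        qed
        then have "dec_rearr u (maximal f) t * ennreal (V t) \<le> ennreal (D * N / V t) * ennreal (V t)"
          by (rule mult_right_mono) simp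
        also have "\<dots> = ennreal (D * N)" using Vt D N by (simp add: ennreal_mult[symmetric])
        finally show ?thesis using D N by (simp add: V_def ennreal_mult)
      qed
    qed
  qed
  then show ?thesis by (auto simp: maximal_bounded_def)
qed

end
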